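(* Let $E$ be a Dedekind complete vector lattice and let $T$ be a positive operator on $E$ which admits a superinvariant pair $(e,\varphi)$. Let $A_n := \frac1n \sum_{k=0}^{n-1} T^k$ for $n \in \mathbb{N}$, and let $E^u$ be the universal completion of $E$. Then the following assertions hold: (i) For each $x \in E$, the set $\{A_n |x| : n \in \mathbb{N}\}$ is order bounded in $E^u$; hence $Mx := \sup_{n \in \mathbb{N}} A_n|x|$ exists in $E^u$. (ii) For each $x \in E$ and $\lambda > 0$, let $q_\lambda(x)$ denote the image of $e$ under the band projection of $E^u$ onto the band generated by $(M|x| - \lambda e)^+$ in $E^u$. Then $q_\lambda(x) \in E$ and $$\lambda\, \varphi(q_\lambda(x)) \le \varphi(|x|).$$
   Context: A positive operator is a linear map $T \colon E \to E$ with $T(E_+) \subseteq E_+$. For a positive linear functional $\varphi$ on $E$, $T'\varphi := \varphi \circ T$. A pair $(e,\varphi)$ is a superinvariant pair for $T$ if: (a) $e \in E_+$ is a weak unit (i.e. $x \wedge e = 0$, $x \in E_+$, imply $x=0$) and $Te \le e$; (b) $\varphi$ is a positive linear functional on $E$ that is strictly positive ($\varphi(x) > 0$ for each $0 < x \in E_+$), $\sigma$-order continuous ($x_n \downarrow 0$ implies $\varphi(x_n) \to 0$ for sequences), and satisfies $T'\varphi \le \varphi$, i.e. $\varphi(Tx) \le \varphi(x)$ for all $x \in E_+$. The universal completion $E^u$ of an Archimedean vector lattice $E$ is the (unique up to lattice isomorphism) universally complete vector lattice (i.e. Dedekind complete, and every non-empty pairwise disjoint family of positive elements has a supremum) containing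 $E$ as an order dense sublattice (for each $0 < x \in E^u$ there is $y \in E$ with $0 < y \le x$). In a Dedekind complete vector lattice $F$ every band $B$ satisfies $F = B \oplus B^\perp$, and the band projection onto $B$ is the projection onto $B$ with kernel $B^\perp$. *)

theory Defs
  imports "HOL-Analysis.Analysis" "HOL-Library.Lattice_Algebras" "HOL-Library.Lub_Glb"
begin

class vector_lattice = ordered_real_vector + lattice_ab_group_add_abs

class dedekind_complete_vector_lattice = vector_lattice + conditionally_complete_lattice

text \<open>The conclusion of the axiom states that \<^term>\<open>S\<close> has a supremum.\<close>

class universally_complete_vector_lattice = dedekind_complete_vector_lattice +
  assumes disjoint_complete:
    "S \<noteq> {} \<Longrightarrow> (\<And>x. x \<in> S \<Longrightarrow> 0 \<le> x) \<Longrightarrow> pairwise (\<lambda>x y. inf x y = 0) S \<Longrightarrow>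
      \<exists>s. (\<forall>x\<in>S. x \<le> s) \<and> (\<forall>b. (\<forall>x\<in>S. x \<le> b) \<longrightarrow> s \<le> b)"

text \<open>
  A universal completion of a vector lattice \<open>E\<close> is given by its embedding into a universally
  complete vector lattice. As universal completions are unique only up to lattice isomorphism,
  they are treated relationally: statements about \<open>E\<^sup>u\<close> are about every \<open>J\<close> satisfying this predicate.
\<close>

definition universal_completion ::
    "('a::vector_lattice \<Rightarrow> 'u::universally_complete_vector_lattice) \<Rightarrow> bool" where
  "universal_completion J \<longleftrightarrow>
    linear J \<and> inj J \<and>
    (\<forall>x y. J (sup x y) = sup (J x) (J y)) \<and> (\<forall>x y. J (inf x y) = inf (J x) (J y)) \<and>
    (\<forall>u>0. \<exists>y. 0 < J y \<and> J y \<le> u)"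

text \<open>Covers both positive operators and positive linear functionals (with codomain \<^typ>\<open>real\<close>).\<close>

definition positive_linear :: "('a::ordered_real_vector \<Rightarrow> 'b::ordered_real_vector) \<Rightarrow> bool" where
  "positive_linear T \<longleftrightarrow> linear T \<and> (\<forall>x\<ge>0. T x \<ge> 0)"

definition weak_unit :: "'a::vector_lattice \<Rightarrow> bool" where
  "weak_unit e \<longleftrightarrow> 0 \<le> e \<and> (\<forall>x\<ge>0. inf x e = 0 \<longrightarrow> x = 0)"

definition strictly_positive :: "('a::vector_lattice \<Rightarrow> real) \<Rightarrow> bool" where
  "strictly_positive \<phi> \<longleftrightarrow> (\<forall>x>0. \<phi> x > 0)"

definition sigma_order_continuous :: "('a::vector_lattice \<Rightarrow> real) \<Rightarrow> bool" where
  "sigma_order_continuous \<phi> \<longleftrightarrow>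
    (\<forall>X::nat \<Rightarrow> 'a. decseq X \<longrightarrow> isGlb UNIV (range X) 0 \<longrightarrow> (\<lambda>n. \<phi> (X n)) \<longlonglongrightarrow> 0)"

definition superinvariant_pair ::
    "('a::vector_lattice \<Rightarrow> 'a) \<Rightarrow> 'a \<Rightarrow> ('a \<Rightarrow> real) \<Rightarrow> bool" where
  "superinvariant_pair T e \<phi> \<longleftrightarrow>
    weak_unit e \<and> T e \<le> e \<and>
    positive_linear \<phi> \<and> strictly_positive \<phi> \<and> sigma_order_continuous \<phi> \<and>
    (\<forall>x\<ge>0. \<phi> (T x) \<le> \<phi> x)"

definition cesaro_mean :: "('a::real_vector \<Rightarrow> 'a) \<Rightarrow> nat \<Rightarrow> 'a \<Rightarrow> 'a" where
  "cesaro_mean T n x = (1 / real n) *\<^sub>R (\<Sum>k<n. (T ^^ k) x)"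

definition order_ideal :: "'a::vector_lattice set \<Rightarrow> bool" where
  "order_ideal I \<longleftrightarrow> subspace I \<and> (\<forall>x y. y \<in> I \<and> \<bar>x\<bar> \<le> \<bar>y\<bar> \<longrightarrow> x \<in> I)"

definition band :: "'a::vector_lattice set \<Rightarrow> bool" where
  "band B \<longleftrightarrow> order_ideal B \<and> (\<forall>D s. D \<subseteq> B \<and> isLub UNIV D s \<longrightarrow> s \<in> B)"

definition disjoint_complement :: "'a::vector_lattice set \<Rightarrow> 'a set" where
  "disjoint_complement B = {x. \<forall>y\<in>B. inf \<bar>x\<bar> \<bar>y\<bar> = 0}"

text \<open>
  The projection along \<open>F = B \<oplus> B\<^sup>\<bottom>\<close>; the description is uniquely satisfied when \<^term>\<open>B\<close> is a
  band, because the lattice is Dedekind complete.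
\<close>

definition band_projection ::
    "'a::dedekind_complete_vector_lattice set \<Rightarrow> 'a \<Rightarrow> 'a" where
  "band_projection B x = (THE y. y \<in> B \<and> x - y \<in> disjoint_complement B)"

text \<open>
  In the next two definitions \<^term>\<open>J\<close> is the embedding of \<open>E\<close> into \<open>E\<^sup>u\<close>. The averages range
  over \<open>n \<ge> 1\<close>, and \<^const>\<open>Sup\<close> is meaningful only once they are known to be bounded above.
\<close>

definition maximal_function ::
    "('a::vector_lattice \<Rightarrow> 'u::dedekind_complete_vector_lattice) \<Rightarrow> ('a \<Rightarrow> 'a) \<Rightarrow> 'a \<Rightarrow> 'u" where
  "maximal_function J T x = (SUP n\<in>{1..}. J (cesaro_mean T n \<bar>x\<bar>))"

text \<open>\<^const>\<open>pprt\<close> is the positive part, and \<open>band hull {u}\<close> is the band generated by \<open>u\<close>.\<close>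

definition level_component ::
    "('a::vector_lattice \<Rightarrow> 'u::dedekind_complete_vector_lattice) \<Rightarrow> ('a \<Rightarrow> 'a) \<Rightarrow> 'a \<Rightarrow>
      real \<Rightarrow> 'a \<Rightarrow> 'u" where
  "level_component J T e c x =
    band_projection (band hull {pprt (maximal_function J T \<bar>x\<bar> - c *\<^sub>R J e)}) (J e)"

end

theory Submission
  imports Defs
begin

text \<open>
  The averages \<open>A\<^sub>n \<bar>x\<bar>\<close> exceed \<open>c e\<close> for some \<open>n \<le> m\<close> only where the maximum of the partial sums
  \<open>\<Sum>k<n. T\<^sup>k (\<bar>x\<bar> - c e)\<close>, \<open>n \<le> m + 1\<close>, is positive, because \<open>T\<^sup>k e \<le> e\<close>. Let \<open>G\<close> be its positive part. As in
  Garsia's proof of Hopf's maximal ergodic theorem, \<open>c h + G \<le> \<bar>x\<bar> + T G\<close> for every \<open>h\<close> with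
  \<open>0 \<le> h \<le> e\<close> supported where \<open>G\<close> is; applying \<open>\<phi>\<close> gives \<open>c \<phi>(h) \<le> \<phi>(\<bar>x\<bar>)\<close>. Hence the component \<open>q\<close>
  of \<open>e\<close> on which some average exceeds \<open>c e\<close> satisfies \<open>c \<phi>(q) \<le> \<phi>(\<bar>x\<bar>)\<close>, and it decreases to \<open>0\<close> as
  \<open>c\<close> grows. So \<open>e\<close> splits into disjoint pieces on each of which the averages are bounded by a multiple
  of \<open>e\<close>, and these bounds have a supremum in the universal completion.
\<close>

subsection \<open>Disjointness in vector lattices\<close>

lemma isLub_UNIV_iff:
  "isLub UNIV S s \<longleftrightarrow> (\<forall>x\<in>S. x \<le> s) \<and> (\<forall>b. (\<forall>x\<in>S. x \<le> b) \<longrightarrow> s \<le> b)"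
  by (auto simp: isLub_def leastP_def isUb_def setle_def setge_def)

lemma isGlb_UNIV_iff:
  "isGlb UNIV S s \<longleftrightarrow> (\<forall>x\<in>S. s \<le> x) \<and> (\<forall>b. (\<forall>x\<in>S. b \<le> x) \<longrightarrow> b \<le> s)"
  by (auto simp: isGlb_def greatestP_def isLb_def setle_def setge_def)

text \<open>Distributing \<open>+\<close> over \<open>inf\<close> turns the right-hand side into the
  infimum of \<open>a + a\<close>, \<open>a + c\<close>, \<open>b + a\<close> and
  \<open>b + c\<close>.\<close>

lemma inf_le_inf_add_inf:
  fixes a b c :: "'a::vector_lattice"
  assumes "0 \<le> a" "0 \<le> b" "0 \<le> c"
  shows "inf a (b + c) \<le> inf a b + inf a c"
proof -
  have "inf a (b + c) \<le> a + a" "inf a (b + c) \<le> a + c"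
    using assms by (auto intro: le_infI1 add_increasing2)
  moreover have "inf a (b + c) \<le> b + a"
    using assms by (auto intro: le_infI1 add_increasing)
  ultimately show ?thesis
    by (simp add: add_inf_distrib_left add_inf_distrib_right)
qed

lemma disjoint_add:
  fixes a b c :: "'a::vector_lattice"
  assumes "inf a b = 0" "inf a c = 0"
  shows "inf a (b + c) = 0"
proof -
  have p: "0 \<le> a" "0 \<le> b" "0 \<le> c"
    using assms by (metis inf.cobounded1 inf.cobounded2)+
  then have "inf a (b + c) \<le> 0"
    using inf_le_inf_add_inf[of a b c] assms by simp
  moreover have "0 \<le> inf a (b + c)"
    using p by simp
  ultimately show ?thesis by (rule antisym)
qed

lemma disjoint_mono:
  fixes a b :: "'a::vector_lattice"
  assumes "inf a b = 0" "0 \<le> a'" "a' \<le> a" "0 \<le> b'" "b' \<le> b"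
  shows "inf a' b' = 0"
  using assms by (metis inf_mono le_inf_iff antisym)

lemma disjoint_scale_nat:
  fixes a b :: "'a::vector_lattice"
  assumes "inf a b = 0"
  shows "inf a (real n *\<^sub>R b) = 0"
proof (induction n)
  case 0
  from assms have "0 \<le> a" by (metis inf.cobounded1)
  then show ?case by (simp add: inf_absorb2)
next
  case (Suc n)
  then show ?case
    using disjoint_add[OF assms Suc] by (simp add: scaleR_add_left)
qed

lemma disjoint_scale:
  fixes a b :: "'a::vector_lattice"
  assumes "inf a b = 0" "0 \<le> r"
  shows "inf a (r *\<^sub>R b) = 0"
proof -
  have p: "0 \<le> a" "0 \<le> b"
    using assms(1) by (metis inf.cobounded1 inf.cobounded2)+
  obtain n where "r \<le> real n" using real_arch_simple by blast
  then have "r *\<^sub>R b \<le> real n *\<^sub>R b"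
    using p by (simp add: scaleR_right_mono)
  then show ?thesis
    by (intro disjoint_mono[OF disjoint_scale_nat[OF assms(1), of n] p(1)])
      (use p assms(2) in \<open>simp_all add: scaleR_nonneg_nonneg\<close>)
qed

lemma disjoint_sum_dominates:
  fixes a b c :: "'a::vector_lattice"
  assumes "0 \<le> a" "0 \<le> b" "inf a c = 0" "a \<le> b + c"
  shows "a \<le> b"
proof -
  have "0 \<le> c" using assms(3) by (metis inf.cobounded2)
  then have "inf a (b + c) \<le> inf a b + inf a c"
    using assms by (intro inf_le_inf_add_inf)
  then show ?thesis using assms by (simp add: inf_absorb1)
qed

lemma inf_pprt_pprt_uminus:
  fixes a :: "'a::vector_lattice"
  shows "inf (pprt a) (pprt (- a)) = 0"
proof -
  have "pprt a = a + pprt (- a)"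
    using prts[of a] by (metis pprt_neg add_uminus_conv_diff eq_diff_eq)
  then have "inf (pprt a) (pprt (- a)) = inf (a + pprt (- a)) (0 + pprt (- a))"
    by simp
  also have "\<dots> = nprt a + pprt (- a)"
    by (simp only: nprt_def add_inf_distrib_right)
  finally show ?thesis by (simp add: pprt_neg)
qed

lemma pprt_le_iff:
  fixes a b :: "'a::vector_lattice"
  shows "pprt a \<le> b \<longleftrightarrow> a \<le> b \<and> 0 \<le> b"
  by (simp add: pprt_def)

text \<open>Since \<open>a + d = sup a d + inf a d\<close>, every \<open>d\<close> in
  \<open>D\<close> lies below \<open>b + sup a y - a\<close>, a bound independent of
  \<open>d\<close>. This is distributivity of \<open>inf\<close> over an arbitrary supremum
  \<open>y\<close> of \<open>D\<close>.\<close>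

lemma inf_le_if_cofinal:
  fixes a b y :: "'a::vector_lattice"
  assumes lub: "\<And>b. (\<And>d. d \<in> D \<Longrightarrow> d \<le> b) \<Longrightarrow> y \<le> b"
    and le: "\<And>d. d \<in> D \<Longrightarrow> inf a d \<le> b" "\<And>d. d \<in> D \<Longrightarrow> d \<le> y"
  shows "inf a y \<le> b"
proof -
  have "y \<le> b + sup a y - a"
  proof (rule lub)
    fix d assume d: "d \<in> D"
    have "d = sup a d + inf a d - a"
      by (simp flip: add_eq_inf_sup)
    also have "\<dots> \<le> sup a y + b - a"
      using le d by (intro diff_right_mono add_mono sup_mono) auto
    finally show "d \<le> b + sup a y - a" by (simp add: add.commute)
  qed
  then have "a + y \<le> b + sup a y" by (simp add: algebra_simps)
  then have "sup a y + inf a y \<le> b + sup a y" by (simp flip: add_eq_inf_sup)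
  then show ?thesis by (simp add: add.commute)
qed

text \<open>The supremum of the multiples absorbs one more copy of \<open>w\<close>, so
  \<open>w \<le> 0\<close>.\<close>

lemma dedekind_complete_archimedean:
  fixes w b :: "'a::dedekind_complete_vector_lattice"
  assumes "0 \<le> w" "\<And>n::nat. real n *\<^sub>R w \<le> b"
  shows "w = 0"
proof -
  let ?R = "range (\<lambda>n::nat. real n *\<^sub>R w)"
  have bdd: "bdd_above ?R" using assms(2) by (intro bdd_aboveI[of _ b]) auto
  have "Sup ?R \<le> Sup ?R - w"
  proof (rule cSup_least)
    fix x assume "x \<in> ?R"
    then obtain n :: nat where n: "x = real n *\<^sub>R w" by blast
    have "real (Suc n) *\<^sub>R w \<le> Sup ?R"
      by (rule cSup_upper[OF rangeI bdd])
    then show "x \<le> Sup ?R - w"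
      by (simp add: n algebra_simps)
  qed simp
  then have "w \<le> 0" by (simp add: algebra_simps)
  then show ?thesis using assms(1) by (rule antisym)
qed

subsection \<open>Exceedance components\<close>

text \<open>For increasing \<open>A\<close> the supremum defining \<open>exceedance e A c\<close> is the component of \<open>e\<close> in the
  band on which some \<open>A m\<close> exceeds \<open>c e\<close>. Letting the same index count the multiples makes it a
  supremum of a sequence, as \<open>\<sigma>\<close>-order continuity requires.\<close>

definition exceedance_seq ::
    "'a::dedekind_complete_vector_lattice \<Rightarrow> (nat \<Rightarrow> 'a) \<Rightarrow> real \<Rightarrow> nat \<Rightarrow> 'a" where
  "exceedance_seq e A c m = inf e (real m *\<^sub>R pprt (A m - c *\<^sub>R e))"

definition exceedance ::
    "'a::dedekind_complete_vector_lattice \<Rightarrow> (nat \<Rightarrow> 'a) \<Rightarrow> real \<Rightarrow> 'a" where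
  "exceedance e A c = (SUP m. exceedance_seq e A c m)"

lemma bdd_above_exceedance_seq: "bdd_above (range (exceedance_seq e A c))"
  by (rule bdd_aboveI[of _ e]) (auto simp: exceedance_seq_def)

lemma exceedance_seq_le: "exceedance_seq e A c m \<le> exceedance e A c"
  unfolding exceedance_def by (rule cSUP_upper[OF UNIV_I bdd_above_exceedance_seq])

lemma exceedance_least: "(\<And>m. exceedance_seq e A c m \<le> b) \<Longrightarrow> exceedance e A c \<le> b"
  unfolding exceedance_def by (rule cSUP_least) auto

lemma exceedance_seq_nonneg: "0 \<le> e \<Longrightarrow> 0 \<le> exceedance_seq e A c m"
  by (simp add: exceedance_seq_def scaleR_nonneg_nonneg)

lemma exceedance_nonneg: "0 \<le> e \<Longrightarrow> 0 \<le> exceedance e A c"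
  using exceedance_seq_nonneg exceedance_seq_le order_trans by blast

lemma exceedance_le: "exceedance e A c \<le> e"
  by (rule exceedance_least) (simp add: exceedance_seq_def)

text \<open>The index \<open>max k m\<close> raises the multiple and the term of \<open>A\<close> at
  once, so a single index loses nothing against two independent ones.\<close>

lemma multiple_le_exceedance:
  assumes "incseq A"
  shows "inf e (real k *\<^sub>R pprt (A m - c *\<^sub>R e)) \<le> exceedance e A c"
proof -
  let ?n = "max k m"
  have "A m \<le> A ?n" using assms by (simp add: incseqD)
  then have "real k *\<^sub>R pprt (A m - c *\<^sub>R e) \<le> real ?n *\<^sub>R pprt (A ?n - c *\<^sub>R e)"
    by (intro scaleR_mono pprt_mono) auto
  then have "inf e (real k *\<^sub>R pprt (A m - c *\<^sub>R e)) \<le> exceedance_seq e A c ?n"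
    unfolding exceedance_seq_def by (rule inf_mono[OF order_refl])
  then show ?thesis using exceedance_seq_le by (rule order_trans)
qed

lemma incseq_exceedance_seq:
  assumes "incseq A"
  shows "incseq (exceedance_seq e A c)"
proof (rule incseq_SucI)
  fix m
  have "A m \<le> A (Suc m)" using assms by (simp add: incseq_SucD)
  then have "real m *\<^sub>R pprt (A m - c *\<^sub>R e) \<le> real (Suc m) *\<^sub>R pprt (A (Suc m) - c *\<^sub>R e)"
    by (intro scaleR_mono pprt_mono) auto
  then show "exceedance_seq e A c m \<le> exceedance_seq e A c (Suc m)"
    unfolding exceedance_seq_def by (rule inf_mono[OF order_refl])
qed

lemma exceedance_antimono:
  assumes "0 \<le> e" "c \<le> c'"
  shows "exceedance e A c' \<le> exceedance e A c"
proof (rule exceedance_least)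
  fix m
  have "c *\<^sub>R e \<le> c' *\<^sub>R e" using assms by (simp add: scaleR_right_mono)
  then have "exceedance_seq e A c' m \<le> exceedance_seq e A c m"
    unfolding exceedance_seq_def
    by (intro inf_mono order_refl scaleR_left_mono pprt_mono diff_left_mono) auto
  then show "exceedance_seq e A c' m \<le> exceedance e A c"
    using exceedance_seq_le by (rule order_trans)
qed

text \<open>By induction every multiple of the common part \<open>w\<close> stays below
  \<open>e\<close>: what lies below \<open>e\<close> and a multiple of the excess is below the
  exceedance, and one more \<open>w\<close> fits into its complement. The Archimedean property then
  forces \<open>w = 0\<close>.\<close>

lemma exceedance_complement_disjoint:
  assumes "0 \<le> e" "incseq A"
  shows "inf (e - exceedance e A c) (pprt (A m - c *\<^sub>R e)) = 0"
proof -
  let ?q = "exceedance e A c"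
  let ?g = "pprt (A m - c *\<^sub>R e)"
  define w where "w = inf (e - ?q) ?g"
  have w: "0 \<le> w" by (simp add: w_def exceedance_le)
  have "real n *\<^sub>R w \<le> e" for n
  proof (induction n)
    case 0
    then show ?case using assms by simp
  next
    case (Suc n)
    have "real n *\<^sub>R w \<le> real n *\<^sub>R ?g"
      by (simp add: w_def scaleR_left_mono)
    with Suc have "real n *\<^sub>R w \<le> ?q"
      using multiple_le_exceedance[OF assms(2), of e n m c] by (meson le_infI order_trans)
    moreover have "w \<le> e - ?q" by (simp add: w_def)
    ultimately have "real n *\<^sub>R w + w \<le> ?q + (e - ?q)"
      by (rule add_mono)
    then show ?case by (simp add: algebra_simps)
  qed
  with w show ?thesis
    unfolding w_def by (rule dedekind_complete_archimedean)
qed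

lemma exceedance_component:
  assumes "0 \<le> e" "incseq A"
  shows "inf (e - exceedance e A c) (exceedance e A c) = 0"
proof (rule antisym)
  show "inf (e - exceedance e A c) (exceedance e A c) \<le> 0"
  proof (rule inf_le_if_cofinal[of "range (exceedance_seq e A c)"])
    fix b assume "\<And>d. d \<in> range (exceedance_seq e A c) \<Longrightarrow> d \<le> b"
    then show "exceedance e A c \<le> b" by (auto intro: exceedance_least)
  next
    fix d assume "d \<in> range (exceedance_seq e A c)"
    then obtain m where d: "d = exceedance_seq e A c m" by blast
    show "d \<le> exceedance e A c" by (simp add: d exceedance_seq_le)
    have "inf (e - exceedance e A c) (real m *\<^sub>R pprt (A m - c *\<^sub>R e)) = 0"
      by (rule disjoint_scale_nat[OF exceedance_complement_disjoint[OF assms]])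
    moreover have "d \<le> real m *\<^sub>R pprt (A m - c *\<^sub>R e)"
      by (simp add: d exceedance_seq_def)
    ultimately show "inf (e - exceedance e A c) d \<le> 0"
      by (metis inf_mono order_refl)
  qed
  show "0 \<le> inf (e - exceedance e A c) (exceedance e A c)"
    using assms by (simp add: exceedance_le exceedance_nonneg)
qed

lemma functional_exceedance_le:
  assumes phi: "positive_linear \<phi>" "sigma_order_continuous \<phi>"
    and A: "incseq A"
    and le: "\<And>m. \<phi> (exceedance_seq e A c m) \<le> b"
  shows "\<phi> (exceedance e A c) \<le> b"
proof -
  \<comment> \<open>Continuity speaks of sequences decreasing to \<open>0\<close>, so it is applied
    to the gaps below the supremum.\<close>
  define X where "X m = exceedance e A c - exceedance_seq e A c m" for m
  have "decseq X"
    using incseq_exceedance_seq[OF A, of e c]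
    by (auto simp: X_def monotone_def intro: diff_left_mono)
  moreover have "isGlb UNIV (range X) 0"
    unfolding isGlb_UNIV_iff
  proof (intro conjI ballI allI impI)
    fix x assume "x \<in> range X"
    then show "0 \<le> x" by (auto simp: X_def exceedance_seq_le)
  next
    fix z assume "\<forall>x\<in>range X. z \<le> x"
    then have "exceedance_seq e A c m \<le> exceedance e A c - z" for m
      by (auto simp: X_def algebra_simps)
    then have "exceedance e A c \<le> exceedance e A c - z"
      by (rule exceedance_least)
    then show "z \<le> 0" by (simp add: algebra_simps)
  qed
  ultimately have "(\<lambda>m. \<phi> (X m)) \<longlonglongrightarrow> 0"
    using phi(2) unfolding sigma_order_continuous_def by blast
  moreover have "\<phi> (exceedance e A c) - b \<le> \<phi> (X m)" for m
    using le[of m] phi(1) by (simp add: X_def positive_linear_def linear_diff)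
  ultimately have "\<phi> (exceedance e A c) - b \<le> 0"
    by (intro LIMSEQ_le_const) auto
  then show ?thesis by simp
qed

subsection \<open>Bands\<close>

lemma band_disjoint_complement_singleton:
  fixes v :: "'a::vector_lattice"
  assumes "0 \<le> v"
  shows "band (disjoint_complement {v})"
proof -
  have mem: "x \<in> disjoint_complement {v} \<longleftrightarrow> inf v \<bar>x\<bar> = 0" for x
    using assms by (simp add: disjoint_complement_def inf_commute)
  have solid: "x \<in> disjoint_complement {v}"
    if "y \<in> disjoint_complement {v}" "\<bar>x\<bar> \<le> \<bar>y\<bar>" for x y
    using that assms unfolding mem by (auto elim: disjoint_mono)
  have "order_ideal (disjoint_complement {v})"
    unfolding order_ideal_def
  proof (intro conjI subspaceI allI impI)
    show "0 \<in> disjoint_complement {v}"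
      using assms by (simp add: mem inf_absorb2)
  next
    fix x y assume "x \<in> disjoint_complement {v}" "y \<in> disjoint_complement {v}"
    then have "inf v (\<bar>x\<bar> + \<bar>y\<bar>) = 0"
      unfolding mem by (rule disjoint_add)
    then show "x + y \<in> disjoint_complement {v}"
      unfolding mem by (rule disjoint_mono) (use assms abs_triangle_ineq in auto)
  next
    fix c :: real and x assume "x \<in> disjoint_complement {v}"
    then have *: "inf v (\<bar>c\<bar> *\<^sub>R \<bar>x\<bar>) = 0"
      unfolding mem by (rule disjoint_scale) simp
    have "c *\<^sub>R x \<le> \<bar>c\<bar> *\<^sub>R \<bar>x\<bar>" for c :: real
    proof (cases "0 \<le> c")
      case True
      then show ?thesis by (simp add: scaleR_left_mono abs_ge_self)
    next
      case False
      then have "(- c) *\<^sub>R (- x) \<le> (- c) *\<^sub>R \<bar>x\<bar>"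
        by (intro scaleR_left_mono abs_ge_minus_self) auto
      with False show ?thesis by simp
    qed
    from this[of c] this[of "- c"] have "\<bar>c *\<^sub>R x\<bar> \<le> \<bar>c\<bar> *\<^sub>R \<bar>x\<bar>"
      by (intro abs_leI) auto
    with * show "c *\<^sub>R x \<in> disjoint_complement {v}"
      unfolding mem using assms by (auto elim: disjoint_mono)
  next
    fix x y assume "y \<in> disjoint_complement {v} \<and> \<bar>x\<bar> \<le> \<bar>y\<bar>"
    then show "x \<in> disjoint_complement {v}" using solid by blast
  qed
  moreover have "s \<in> disjoint_complement {v}"
    if D: "D \<subseteq> disjoint_complement {v}" "isLub UNIV D s" for D s
  proof (cases "D = {}")
    case True
    \<comment> \<open>A supremum of the empty set is a least element of the whole space; comparing
      it with \<open>0\<close> and \<open>s + s\<close> forces \<open>s = 0\<close>.\<close>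
    then have "s \<le> b" for b using D(2) by (simp add: isLub_UNIV_iff)
    from this[of 0] this[of "s + s"] have "s = 0" by (intro antisym) auto
    then show ?thesis using assms by (simp add: mem inf_absorb2)
  next
    case False
    then obtain d where d: "d \<in> D" by blast
    have lub: "x \<le> s" if "x \<in> D" for x using D(2) that by (simp add: isLub_UNIV_iff)
    have least: "s \<le> b" if "\<And>x. x \<in> D \<Longrightarrow> x \<le> b" for b
      using D(2) that by (simp add: isLub_UNIV_iff)
    have parts: "inf v (pprt x) = 0" "inf v (pprt (- x)) = 0" if "x \<in> D" for x
    proof -
      have "inf v \<bar>x\<bar> = 0" using that D(1) mem by blast
      moreover have "pprt x \<le> \<bar>x\<bar>" "pprt (- x) \<le> \<bar>x\<bar>"
        by (simp_all add: pprt_le_iff abs_ge_self abs_ge_minus_self)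
      ultimately show "inf v (pprt x) = 0" "inf v (pprt (- x)) = 0"
        using assms by (meson disjoint_mono order_refl zero_le_pprt)+
    qed
    \<comment> \<open>The positive parts of the elements of \<open>D\<close> have supremum
      \<open>pprt s\<close>. For the negative part below, one element suffices:
      \<open>d \<le> s\<close> gives \<open>pprt (- s) \<le> pprt (- d)\<close>.\<close>
    have "inf v (pprt s) \<le> 0"
    proof (rule inf_le_if_cofinal[of "pprt ` D"])
      fix b assume b: "\<And>y. y \<in> pprt ` D \<Longrightarrow> y \<le> b"
      then have "x \<le> b" if "x \<in> D" for x
        using that by (meson imageI pprt_le_iff)
      moreover have "0 \<le> b" using b d by (meson imageI pprt_le_iff)
      ultimately show "pprt s \<le> b" by (simp add: pprt_le_iff least)
    qed (auto simp: parts lub pprt_mono)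
    moreover have "0 \<le> inf v (pprt s)" using assms by simp
    ultimately have "inf v (pprt s) = 0" by (rule antisym)
    moreover have "inf v (pprt (- s)) = 0"
      by (rule disjoint_mono[OF parts(2)[OF d]]) (use lub[OF d] assms in auto)
    ultimately have "inf v (pprt s + pprt (- s)) = 0" by (rule disjoint_add)
    then show ?thesis by (simp add: mem abs_prts pprt_neg)
  qed
  ultimately show ?thesis unfolding band_def by blast
qed

text \<open>The elements disjoint from \<open>v\<close> form a band containing \<open>u\<close>,
  hence containing the band generated by \<open>u\<close>.\<close>

lemma hull_band_disjoint:
  fixes u v y :: "'a::vector_lattice"
  assumes "0 \<le> u" "0 \<le> v" "inf u v = 0" "y \<in> band hull {u}"
  shows "inf v \<bar>y\<bar> = 0"
proof -
  have "{u} \<subseteq> disjoint_complement {v}"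
    using assms by (simp add: disjoint_complement_def)
  then have "band hull {u} \<subseteq> disjoint_complement {v}"
    using band_disjoint_complement_singleton[OF assms(2)] by (rule hull_minimal)
  with assms show ?thesis
    by (auto simp: disjoint_complement_def inf_commute)
qed

lemma band_hull: "band (band hull S)"
proof (rule hull_in)
  fix F :: "'a set set" assume F: "Ball F band"
  have "subspace (\<Inter>F)"
    using F by (intro subspace_Inter) (auto simp: band_def order_ideal_def)
  moreover have "x \<in> \<Inter>F" if "y \<in> \<Inter>F \<and> \<bar>x\<bar> \<le> \<bar>y\<bar>" for x y
    using F that unfolding band_def order_ideal_def by (metis InterE InterI)
  moreover have "s \<in> \<Inter>F" if "D \<subseteq> \<Inter>F \<and> isLub UNIV D s" for D s
    using F that unfolding band_def by (metis Inter_greatest Inter_lower InterI order_trans)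
  ultimately show "band (\<Inter>F)"
    unfolding band_def order_ideal_def by blast
qed

lemma subspace_band: "band B \<Longrightarrow> subspace B"
  by (simp add: band_def order_ideal_def)

lemma band_isLub: "band B \<Longrightarrow> D \<subseteq> B \<Longrightarrow> isLub UNIV D s \<Longrightarrow> s \<in> B"
  unfolding band_def by blast

text \<open>Two candidates differ by an element of \<open>B\<close>; it is disjoint from both
  remainders but dominated by the sum of their moduli, so it is \<open>0\<close>.\<close>

lemma band_projection_eq:
  fixes B :: "'a::dedekind_complete_vector_lattice set"
  assumes B: "band B" and y: "y \<in> B" "x - y \<in> disjoint_complement B"
  shows "band_projection B x = y"
  unfolding band_projection_def
proof (rule the_equality)
  fix z assume z: "z \<in> B \<and> x - z \<in> disjoint_complement B"
  have "y - z \<in> B" using B y z by (auto dest: subspace_band intro: subspace_diff)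
  then have "inf \<bar>y - z\<bar> \<bar>x - y\<bar> = 0" "inf \<bar>y - z\<bar> \<bar>x - z\<bar> = 0"
    using y z by (auto simp: disjoint_complement_def inf_commute)
  then have "inf \<bar>y - z\<bar> (\<bar>x - z\<bar> + \<bar>x - y\<bar>) = 0" by (intro disjoint_add)
  moreover have "\<bar>y - z\<bar> \<le> \<bar>x - z\<bar> + \<bar>x - y\<bar>"
    using abs_triangle_ineq4[of "x - z" "x - y"] by simp
  ultimately show "z = y" by (simp add: inf_absorb1)
qed (use y in simp)

subsection \<open>The maximal inequality\<close>

text \<open>On \<open>{S > 0}\<close> (here \<open>S\<close> is the maximum of the partial sums and \<open>h\<close> is supported there) the
  left-hand side is below \<open>c e + S\<close>; off that set it vanishes.\<close>

lemma supported_add_pprt_le: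
  fixes S e h a :: "'a::vector_lattice"
  assumes a: "0 \<le> a" "c *\<^sub>R e + S \<le> a"
    and h: "0 \<le> h" "h \<le> e" "h \<le> r *\<^sub>R pprt S"
    and nonneg: "0 \<le> c" "0 \<le> r"
  shows "c *\<^sub>R h + pprt S \<le> a"
proof -
  have ce: "c *\<^sub>R h \<le> c *\<^sub>R e" using h nonneg by (simp add: scaleR_left_mono)
  have "inf (pprt (- S)) (r *\<^sub>R pprt S) = 0"
    using inf_pprt_pprt_uminus[of S] nonneg by (intro disjoint_scale) (auto simp: inf_commute)
  then have "inf (pprt (- S)) h = 0"
    by (rule disjoint_mono) (use h in auto)
  then have "inf (pprt (- S)) (c *\<^sub>R h) = 0"
    using nonneg by (intro disjoint_scale)
  then have "inf (c *\<^sub>R h) (pprt (- S)) = 0" by (simp add: inf_commute)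
  \<comment> \<open>Adding \<open>pprt (- S)\<close> makes \<open>S\<close> nonnegative, so it can
    be discarded; disjointness from \<open>c *\<^sub>R h\<close> then removes
    \<open>pprt (- S)\<close> again.\<close>
  moreover have "c *\<^sub>R h \<le> a + pprt (- S)"
  proof -
    have "nprt S \<le> S" by (simp add: nprt_def)
    then have "0 \<le> S + pprt (- S)" by (simp add: pprt_neg)
    then have "c *\<^sub>R e + 0 \<le> c *\<^sub>R e + (S + pprt (- S))" by (rule add_left_mono)
    also have "\<dots> \<le> a + pprt (- S)" using a by (simp flip: add.assoc)
    finally show ?thesis using ce by simp
  qed
  moreover have "0 \<le> c *\<^sub>R h" using h nonneg by (simp add: scaleR_nonneg_nonneg)
  ultimately have "c *\<^sub>R h \<le> a"
    using a(1) disjoint_sum_dominates by blast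
  moreover have "c *\<^sub>R h + S \<le> a"
    using ce a(2) by (meson add_right_mono order_trans)
  ultimately show ?thesis
    by (simp add: pprt_def add_sup_distrib_left)
qed

text \<open>The index set is finite and nonempty, so the supremum always exists. Running maxima make
  the averages increasing, as the exceedance lemmas require.\<close>

definition running_max :: "(nat \<Rightarrow> 'a::conditionally_complete_lattice) \<Rightarrow> nat \<Rightarrow> 'a" where
  "running_max f m = (SUP n\<in>{..m}. f n)"

lemma le_running_max: "n \<le> m \<Longrightarrow> f n \<le> running_max f m"
  unfolding running_max_def by (rule cSUP_upper) auto

lemma running_max_least: "(\<And>n. n \<le> m \<Longrightarrow> f n \<le> b) \<Longrightarrow> running_max f m \<le> b"
  unfolding running_max_def by (rule cSUP_least) auto

lemma incseq_running_max: "incseq (running_max f)"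
  by (auto simp: monotone_def intro!: running_max_least le_running_max)

lemma positive_linear_mono: "positive_linear T \<Longrightarrow> x \<le> y \<Longrightarrow> T x \<le> T y"
  unfolding positive_linear_def by (metis diff_ge_0_iff_ge linear_diff)

lemma cesaro_mean_nonneg:
  assumes "positive_linear T" "0 \<le> f"
  shows "0 \<le> cesaro_mean T n f"
proof -
  have "0 \<le> (T ^^ k) f" for k
    by (induction k) (use assms in \<open>auto simp: positive_linear_def\<close>)
  then show ?thesis
    by (auto simp: cesaro_mean_def intro!: scaleR_nonneg_nonneg sum_nonneg)
qed

text \<open>The averages are indexed from \<open>0\<close>; by division by zero the additional one is \<open>0\<close>.\<close>

lemma maximal_inequality:
  fixes T :: "'a::dedekind_complete_vector_lattice \<Rightarrow> 'a" and \<phi> :: "'a \<Rightarrow> real"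
  assumes T: "positive_linear T" and phi: "positive_linear \<phi>"
    and e: "0 \<le> e" "T e \<le> e" and sub: "\<And>x. 0 \<le> x \<Longrightarrow> \<phi> (T x) \<le> \<phi> x"
    and f: "0 \<le> f" and c: "0 \<le> c"
  shows "c * \<phi> (exceedance_seq e (running_max (\<lambda>n. cesaro_mean T n f)) c m) \<le> \<phi> f"
proof -
  define g where "g = f - c *\<^sub>R e"
  define s where "s n = (\<Sum>k<n. (T ^^ k) g)" for n
  define S where "S = running_max (\<lambda>n. s (Suc n)) m"
  define h where "h = exceedance_seq e (running_max (\<lambda>n. cesaro_mean T n f)) c m"
  interpret T: linear T using T by (simp add: positive_linear_def)
  have phi_lin: "linear \<phi>" using phi by (simp add: positive_linear_def)
  have s_Suc: "s (Suc n) = g + T (s n)" for n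
    unfolding s_def sum.lessThan_Suc_shift by (simp add: T.sum)
  have iter_e: "(T ^^ k) e \<le> e" for k
  proof (induction k)
    case (Suc k)
    then have "T ((T ^^ k) e) \<le> T e" by (rule positive_linear_mono[OF T])
    then show ?case using e by simp
  qed simp
  \<comment> \<open>Replacing \<open>(T ^^ k) e\<close> by the larger \<open>e\<close> lowers the
    left side, so an average of \<open>f\<close> minus \<open>c *\<^sub>R e\<close> is bounded by an
    average of the iterates of \<open>g\<close>.\<close>
  have iter_g: "(T ^^ k) f - c *\<^sub>R e \<le> (T ^^ k) g" for k
  proof -
    have "(T ^^ k) g = (T ^^ k) f - c *\<^sub>R (T ^^ k) e"
      by (induction k) (simp_all add: g_def T.diff T.scale)
    moreover have "c *\<^sub>R (T ^^ k) e \<le> c *\<^sub>R e"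
      using iter_e c by (rule scaleR_left_mono)
    ultimately show ?thesis by simp
  qed
  \<comment> \<open>\<open>S\<close> is the maximum of \<open>s 1\<close> to
    \<open>s (Suc m)\<close>; its positive part also covers the empty sum
    \<open>s 0 = 0\<close>.\<close>
  have s_le: "s n \<le> pprt S" if "n \<le> Suc m" for n
  proof (cases n)
    case 0
    then show ?thesis by (simp add: s_def)
  next
    case (Suc k)
    then have "s n \<le> S" using that le_running_max[of k m "\<lambda>n. s (Suc n)"] by (simp add: S_def)
    then show ?thesis by (simp add: pprt_def le_supI1)
  qed
  have mean_le: "cesaro_mean T n f - c *\<^sub>R e \<le> pprt S" if "n \<le> m" for n
  proof (cases "n = 0")
    case True
    have "- (c *\<^sub>R e) \<le> 0" using c e by (simp add: scaleR_nonneg_nonneg)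
    then have "- (c *\<^sub>R e) \<le> pprt S" by (rule order_trans) simp
    with True show ?thesis by (simp add: cesaro_mean_def)
  next
    case False
    then have n: "0 < real n" "1 / real n \<le> 1" by auto
    have "cesaro_mean T n f - c *\<^sub>R e = (1 / real n) *\<^sub>R (\<Sum>k<n. (T ^^ k) f - c *\<^sub>R e)"
      using n by (simp add: cesaro_mean_def sum_subtractf scaleR_diff_right sum_constant_scaleR)
    also have "\<dots> \<le> (1 / real n) *\<^sub>R s n"
      unfolding s_def using iter_g by (intro scaleR_left_mono sum_mono) auto
    also have "\<dots> \<le> (1 / real n) *\<^sub>R pprt S"
      using s_le that by (intro scaleR_left_mono) auto
    also have "\<dots> \<le> 1 *\<^sub>R pprt S"
      using n(2) by (rule scaleR_right_mono) simp
    finally show ?thesis by simp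
  qed
  have "running_max (\<lambda>n. cesaro_mean T n f) m \<le> pprt S + c *\<^sub>R e"
    using mean_le by (intro running_max_least) (simp add: algebra_simps)
  then have "pprt (running_max (\<lambda>n. cesaro_mean T n f) m - c *\<^sub>R e) \<le> pprt S"
    by (simp add: pprt_le_iff algebra_simps)
  then have "real m *\<^sub>R pprt (running_max (\<lambda>n. cesaro_mean T n f) m - c *\<^sub>R e) \<le> real m *\<^sub>R pprt S"
    by (rule scaleR_left_mono) simp
  then have h_le: "h \<le> real m *\<^sub>R pprt S"
    unfolding h_def exceedance_seq_def by (rule le_infI2)
  \<comment> \<open>Garsia's step: each \<open>s (Suc n)\<close> is \<open>g + T (s n)\<close>, and
    \<open>s n\<close> is below \<open>pprt S\<close>, including at \<open>n = 0\<close>.\<close>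
  have "S \<le> g + T (pprt S)"
    unfolding S_def
  proof (rule running_max_least, fold S_def)
    fix n assume "n \<le> m"
    then show "s (Suc n) \<le> g + T (pprt S)"
      unfolding s_Suc by (intro add_left_mono positive_linear_mono[OF T] s_le) simp
  qed
  then have "c *\<^sub>R e + S \<le> f + T (pprt S)" by (simp add: g_def algebra_simps)
  moreover have "0 \<le> f + T (pprt S)"
    using f T by (simp add: positive_linear_def)
  moreover have "0 \<le> h" "h \<le> e"
    using e by (simp_all add: h_def exceedance_seq_nonneg) (simp add: exceedance_seq_def)
  ultimately have "c *\<^sub>R h + pprt S \<le> f + T (pprt S)"
    using h_le c by (intro supported_add_pprt_le[where e = e and r = "real m"]) simp_all
  then have "\<phi> (c *\<^sub>R h + pprt S) \<le> \<phi> (f + T (pprt S))"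
    by (rule positive_linear_mono[OF phi])
  then have "c * \<phi> h + \<phi> (pprt S) \<le> \<phi> f + \<phi> (T (pprt S))"
    using phi_lin by (simp add: linear_add linear_scale)
  \<comment> \<open>As \<open>\<phi> (T (pprt S)) \<le> \<phi> (pprt S)\<close>, these two real
    numbers drop out of the inequality.\<close>
  then show ?thesis using sub[of "pprt S"] by (simp add: h_def)
qed

subsection \<open>Embedding into the universal completion\<close>

locale universal_completion_embedding =
  fixes J :: "'a::dedekind_complete_vector_lattice \<Rightarrow> 'u::universally_complete_vector_lattice"
  assumes J: "universal_completion J"
begin

sublocale linear J
  using J by (simp add: universal_completion_def)

lemma sup_eq: "J (sup x y) = sup (J x) (J y)" and inf_eq: "J (inf x y) = inf (J x) (J y)"
  using J by (simp_all add: universal_completion_def)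

lemma le_iff: "J x \<le> J y \<longleftrightarrow> x \<le> y"
proof -
  have "inj J" using J by (simp add: universal_completion_def)
  then show ?thesis by (metis inf_eq injD le_iff_inf)
qed

lemma pprt_eq: "J (pprt x) = pprt (J x)"
  by (simp add: pprt_def sup_eq zero)

lemma nonneg_iff: "0 \<le> J x \<longleftrightarrow> 0 \<le> x"
  using le_iff[of 0 x] by (simp add: zero)

lemma order_dense:
  assumes "0 < u"
  obtains y where "0 < J y" "J y \<le> u"
  using J assms by (auto simp: universal_completion_def)

lemma bdd_above_image: "bdd_above D \<Longrightarrow> bdd_above (J ` D)"
  by (auto simp: bdd_above_def le_iff) (metis le_iff)

text \<open>If there were a gap between the two suprema, order density would place some
  \<open>J z > 0\<close> in it, and \<open>Sup D - z\<close> would be a smaller upper bound of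
  \<open>D\<close>.\<close>

lemma Sup_eq:
  assumes "D \<noteq> {}" "bdd_above D"
  shows "J (Sup D) = Sup (J ` D)"
proof (rule ccontr)
  assume ne: "J (Sup D) \<noteq> Sup (J ` D)"
  have "Sup (J ` D) \<le> J (Sup D)"
    using assms by (intro cSUP_least) (simp_all add: le_iff cSup_upper)
  with ne have "0 < J (Sup D) - Sup (J ` D)" by simp
  then obtain z where z: "0 < J z" "J z \<le> J (Sup D) - Sup (J ` D)" by (rule order_dense)
  have "Sup D \<le> Sup D - z"
  proof (rule cSup_least)
    fix d assume "d \<in> D"
    then have "J d \<le> Sup (J ` D)" using assms bdd_above_image by (intro cSUP_upper)
    also have "\<dots> \<le> J (Sup D) - J z" using z by (simp add: algebra_simps)
    finally show "d \<le> Sup D - z" by (simp flip: diff add: le_iff)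
  qed (use assms in simp)
  then have "z \<le> 0" by simp
  then have "J z \<le> J 0" by (simp only: le_iff)
  with z show False by (simp add: zero)
qed

text \<open>The order bound is glued together from the disjoint pieces \<open>d k\<close> of \<open>e\<close>: by the definition of
  \<open>d k\<close>, each \<open>A m\<close> is at most \<open>(k + 1) e\<close> on the band of \<open>d k\<close>.\<close>

lemma bdd_above_if_exceedance_tendsto_0:
  fixes \<phi> :: "'a \<Rightarrow> real"
  assumes e: "weak_unit e" and A: "incseq A"
    and phi: "positive_linear \<phi>" "strictly_positive \<phi>"
    and lim: "(\<lambda>k. \<phi> (exceedance e A (real k))) \<longlonglongrightarrow> 0"
  shows "bdd_above (range (\<lambda>m. J (A m)))"
proof -
  have e0: "0 \<le> e" using e by (simp add: weak_unit_def)
  \<comment> \<open>Setting \<open>Q 0 = e\<close> lets the layers \<open>d k\<close> start from all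
    of \<open>e\<close>; \<open>exceedance e A 0\<close> may be smaller.\<close>
  define Q where "Q k = (if k = 0 then e else exceedance e A (real k))" for k :: nat
  define d where "d k = Q k - Q (Suc k)" for k
  have Q: "0 \<le> Q k" "Q k \<le> e" for k
    using e0 by (auto simp: Q_def exceedance_nonneg exceedance_le)
  have "decseq Q"
    by (rule decseq_SucI) (auto simp: Q_def exceedance_le e0 intro: exceedance_antimono)
  then have anti: "j \<le> k \<Longrightarrow> Q k \<le> Q j" for j k by (simp add: decseqD)
  have comp: "inf (e - Q k) (Q k) = 0" for k
    using e0 A by (simp add: Q_def exceedance_component inf_absorb1)
  have d0: "0 \<le> d k" for k using anti[of k "Suc k"] by (simp add: d_def)
  have dQ: "d k \<le> Q k" for k using Q[of "Suc k"] by (simp add: d_def)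
  have dQ': "d k \<le> e - Q (Suc k)" for k using Q[of k] by (simp add: d_def)
  have disj_less: "inf (d j) (d k) = 0" if "j < k" for j k
  proof (rule disjoint_mono[OF comp[of "Suc j"]])
    show "d k \<le> Q (Suc j)" using dQ[of k] anti[of "Suc j" k] that by (meson Suc_leI order_trans)
  qed (fact d0 dQ')+
  then have disj: "inf (d j) (d k) = 0" if "j \<noteq> k" for j k
    using that by (metis inf_commute nat_neq_iff)
  \<comment> \<open>The rest of \<open>e\<close> consists of \<open>e - Q k\<close> and
    \<open>Q (Suc k)\<close>, both disjoint from the layer \<open>d k\<close>.\<close>
  have d_comp: "inf (d k) (e - d k) = 0" for k
  proof -
    have "inf (d k) (e - Q k) = 0"
      using comp[of k] by (subst inf_commute, elim disjoint_mono) (auto simp: d0 dQ Q)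
    moreover have "inf (d k) (Q (Suc k)) = 0"
      by (rule disjoint_mono[OF comp[of "Suc k"]]) (auto simp: d0 dQ' Q)
    ultimately have "inf (d k) ((e - Q k) + Q (Suc k)) = 0" by (rule disjoint_add)
    then show ?thesis by (simp add: d_def algebra_simps)
  qed
  have d_exceed: "inf (d k) (pprt (A m - real (Suc k) *\<^sub>R e)) = 0" for k m
    by (rule disjoint_mono[OF exceedance_complement_disjoint[OF e0 A, of "real (Suc k)" m]])
      (use d0 dQ'[of k] in \<open>auto simp: Q_def\<close>)
  define S where "S = range (\<lambda>k. real (Suc k) *\<^sub>R J (d k))"
  have "\<exists>s. (\<forall>x\<in>S. x \<le> s) \<and> (\<forall>b. (\<forall>x\<in>S. x \<le> b) \<longrightarrow> s \<le> b)"
  proof (rule disjoint_complete)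
    show "0 \<le> x" if "x \<in> S" for x
      using that d0 by (auto simp: S_def nonneg_iff intro!: scaleR_nonneg_nonneg)
    show "pairwise (\<lambda>x y. inf x y = 0) S"
    proof (rule pairwiseI)
      fix x y assume "x \<in> S" "y \<in> S" "x \<noteq> y"
      then obtain j k where jk: "x = real (Suc j) *\<^sub>R J (d j)" "y = real (Suc k) *\<^sub>R J (d k)" "j \<noteq> k"
        by (auto simp: S_def)
      have "inf (d j) (real (Suc k) *\<^sub>R d k) = 0"
        using disj[OF jk(3)] by (rule disjoint_scale_nat)
      then have "inf (real (Suc k) *\<^sub>R d k) (real (Suc j) *\<^sub>R d j) = 0"
        by (intro disjoint_scale_nat) (simp add: inf_commute)
      then have "J (inf (real (Suc k) *\<^sub>R d k) (real (Suc j) *\<^sub>R d j)) = 0"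
        by (simp add: zero)
      then show "inf x y = 0" by (simp add: jk inf_eq scale inf_commute)
    qed
  qed (simp add: S_def)
  then obtain s where s: "\<And>k. real (Suc k) *\<^sub>R J (d k) \<le> s" by (auto simp: S_def)
  have "J (A m) \<le> s" for m
  proof (rule ccontr)
    assume "\<not> J (A m) \<le> s"
    then have "0 < pprt (J (A m) - s)"
      using le_zero_iff_zero_pprt[of "J (A m) - s"] by (simp add: less_le)
    then obtain y where y: "0 < J y" "J y \<le> pprt (J (A m) - s)" by (rule order_dense)
    have y0: "0 \<le> y" using y(1) nonneg_iff less_imp_le by blast
    \<comment> \<open>The part \<open>z\<close> of \<open>y\<close> inside \<open>d k\<close> is
      below \<open>?p + ?r\<close>: the excess of \<open>A m\<close> over \<open>(k + 1) e\<close>,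
      plus a multiple of \<open>e - d k\<close>. Both summands are disjoint from
      \<open>d k\<close>.\<close>
    have y_disj: "inf y (d k) = 0" for k
    proof -
      define z where "z = inf y (d k)"
      let ?p = "pprt (A m - real (Suc k) *\<^sub>R e)"
      let ?r = "real (Suc k) *\<^sub>R (e - d k)"
      have z: "0 \<le> z" "z \<le> y" "z \<le> d k" using y0 d0 by (simp_all add: z_def)
      have ed: "0 \<le> e - d k" using dQ[of k] Q[of k] by simp
      have "J z \<le> pprt (J (A m) - s)" using z y by (meson le_iff order_trans)
      also have "\<dots> \<le> pprt (J (A m) - real (Suc k) *\<^sub>R J (d k))"
        using s by (intro pprt_mono diff_left_mono)
      also have "\<dots> = J (pprt (A m - real (Suc k) *\<^sub>R d k))"
        by (simp only: pprt_eq diff scale)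
      finally have "z \<le> pprt (A m - real (Suc k) *\<^sub>R d k)" by (simp only: le_iff)
      also have "\<dots> \<le> ?p + ?r"
        unfolding pprt_le_iff
      proof
        have "A m - real (Suc k) *\<^sub>R d k = (A m - real (Suc k) *\<^sub>R e) + ?r"
          by (simp only: scaleR_diff_right) simp
        also have "\<dots> \<le> ?p + ?r" by (intro add_right_mono) (simp add: pprt_def)
        finally show "A m - real (Suc k) *\<^sub>R d k \<le> ?p + ?r" .
        show "0 \<le> ?p + ?r" using ed by (intro add_nonneg_nonneg scaleR_nonneg_nonneg) auto
      qed
      finally have "z \<le> ?p + ?r" .
      with z(3) have "z \<le> inf (d k) (?p + ?r)" by (rule le_infI)
      also have "\<dots> = 0"
        using d_exceed disjoint_scale_nat[OF d_comp] by (rule disjoint_add)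
      finally show ?thesis using z(1) unfolding z_def by (rule antisym)
    qed
    \<comment> \<open>\<open>e - Q k\<close> is the sum of the first \<open>k\<close>
      layers.\<close>
    have y_compl: "inf y (e - Q k) = 0" for k
    proof (induction k)
      case 0
      show ?case using y0 by (simp add: Q_def inf_absorb2)
    next
      case (Suc k)
      then have "inf y ((e - Q k) + d k) = 0" using y_disj by (rule disjoint_add)
      then show ?case by (simp add: d_def)
    qed
    \<comment> \<open>Being disjoint from every \<open>e - Q k\<close>, \<open>w\<close> lies below
      every \<open>Q k\<close>, so the limit gives \<open>\<phi> w \<le> 0\<close>. Strict
      positivity yields \<open>w = 0\<close>, and the weak unit then yields
      \<open>y = 0\<close>.\<close>
    define w where "w = inf y e"
    have w0: "0 \<le> w" using y0 e0 by (simp add: w_def)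
    have "w \<le> Q k" for k
    proof (rule disjoint_sum_dominates[OF w0 Q(1)])
      show "inf w (e - Q k) = 0"
        by (rule disjoint_mono[OF y_compl]) (use w0 Q in \<open>auto simp: w_def\<close>)
      show "w \<le> Q k + (e - Q k)" by (simp add: w_def)
    qed
    then have "\<phi> w \<le> \<phi> (Q k)" for k by (rule positive_linear_mono[OF phi(1)])
    then have "\<phi> w \<le> \<phi> (exceedance e A (real k))" if "1 \<le> k" for k
      using that by (metis Q_def not_one_le_zero)
    with lim have "\<phi> w \<le> 0" by (intro LIMSEQ_le_const) auto
    then have "w = 0"
      using w0 phi(2) by (auto simp: strictly_positive_def less_le)
    then have "y = 0" using e y0 by (simp add: w_def weak_unit_def)
    with y show False by (simp add: zero)
  qed
  then show ?thesis by (rule bdd_aboveI2)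
qed

text \<open>This places the projection in the range of \<open>J\<close>. The image of the exceedance
  is a supremum of elements dominated by multiples of \<open>u\<close>, hence in the band; its
  complement in \<open>J e\<close> is disjoint from the images of all excesses, whose supremum is
  \<open>u\<close>.\<close>

lemma band_projection_exceedance:
  assumes e: "0 \<le> e" and A: "incseq A" and bdd: "bdd_above (range (\<lambda>m. J (A m)))"
  shows "band_projection (band hull {pprt ((SUP m. J (A m)) - c *\<^sub>R J e)}) (J e) =
    J (exceedance e A c)"
proof -
  define M where "M = (SUP m. J (A m))"
  define u where "u = pprt (M - c *\<^sub>R J e)"
  define v where "v = J e - J (exceedance e A c)"
  have A_le: "J (A m) \<le> M" for m
    unfolding M_def using bdd by (rule cSUP_upper[OF UNIV_I])
  have piece_le: "J (pprt (A m - c *\<^sub>R e)) \<le> u" for m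
    unfolding u_def using A_le by (simp only: pprt_eq diff scale pprt_mono diff_right_mono)
  have u: "0 \<le> u" by (simp add: u_def)
  have v: "0 \<le> v" by (simp add: v_def le_iff exceedance_le)
  have B: "band (band hull {u})" by (rule band_hull)
  have piece_mem: "J (exceedance_seq e A c m) \<in> band hull {u}" for m
  proof -
    have "real m *\<^sub>R u \<in> band hull {u}"
      by (intro subspace_scale subspace_band B) (simp add: hull_inc)
    moreover have "J (exceedance_seq e A c m) \<le> real m *\<^sub>R u"
    proof -
      have "J (exceedance_seq e A c m) \<le> real m *\<^sub>R J (pprt (A m - c *\<^sub>R e))"
        by (simp add: exceedance_seq_def inf_eq scale)
      also have "\<dots> \<le> real m *\<^sub>R u" using piece_le by (rule scaleR_left_mono) simp
      finally show ?thesis .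
    qed
    moreover have "0 \<le> J (exceedance_seq e A c m)"
      using e by (simp add: nonneg_iff exceedance_seq_nonneg)
    ultimately have "\<bar>J (exceedance_seq e A c m)\<bar> \<le> \<bar>real m *\<^sub>R u\<bar>"
      by (simp add: abs_of_nonneg)
    with \<open>real m *\<^sub>R u \<in> band hull {u}\<close> B show ?thesis
      unfolding band_def order_ideal_def by blast
  qed
  have "J (exceedance e A c) = Sup (J ` range (exceedance_seq e A c))"
    unfolding exceedance_def by (rule Sup_eq) (auto simp: bdd_above_exceedance_seq)
  moreover have "bdd_above (J ` range (exceedance_seq e A c))"
    by (intro bdd_above_image bdd_above_exceedance_seq)
  ultimately have "isLub UNIV (J ` range (exceedance_seq e A c)) (J (exceedance e A c))"
    unfolding isLub_UNIV_iff by (auto intro: cSup_upper cSup_least)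
  then have mem: "J (exceedance e A c) \<in> band hull {u}"
    by (rule band_isLub[OF B, rotated]) (use piece_mem in blast)
  have "inf v u \<le> 0"
  proof (rule inf_le_if_cofinal[of "range (\<lambda>m. J (pprt (A m - c *\<^sub>R e)))"])
    fix b assume b: "\<And>y. y \<in> range (\<lambda>m. J (pprt (A m - c *\<^sub>R e))) \<Longrightarrow> y \<le> b"
    then have b': "0 \<le> b" "J (A m) - c *\<^sub>R J e \<le> b" for m
      using rangeI[of "\<lambda>m. J (pprt (A m - c *\<^sub>R e))" m]
      by (force simp: pprt_eq diff scale pprt_le_iff)+
    have "M \<le> b + c *\<^sub>R J e"
      unfolding M_def using b'(2) by (intro cSUP_least) (auto simp: algebra_simps)
    with b' show "u \<le> b" by (simp add: u_def pprt_le_iff algebra_simps)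
  next
    fix y assume "y \<in> range (\<lambda>m. J (pprt (A m - c *\<^sub>R e)))"
    then obtain m where m: "y = J (pprt (A m - c *\<^sub>R e))" by blast
    show "y \<le> u" by (simp only: m piece_le)
    have "inf v y = J (inf (e - exceedance e A c) (pprt (A m - c *\<^sub>R e)))"
      by (simp only: v_def m inf_eq diff)
    then show "inf v y \<le> 0"
      using e A by (simp add: exceedance_complement_disjoint zero)
  qed
  then have "inf u v = 0" using u v by (simp add: antisym inf_commute)
  then have "v \<in> disjoint_complement (band hull {u})"
    using hull_band_disjoint[OF u v] v by (auto simp: disjoint_complement_def)
  with B mem show ?thesis
    unfolding u_def M_def v_def by (intro band_projection_eq)
qed

end

section \<open>Existence of the maximal function and the weak-type inequality for its level
  components\<close>

theorem theorem4p6: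
  fixes T :: "'a::dedekind_complete_vector_lattice \<Rightarrow> 'a"
    and e :: 'a
    and \<phi> :: "'a \<Rightarrow> real"
    and J :: "'a \<Rightarrow> 'u::universally_complete_vector_lattice"
  assumes "positive_linear T"
    and "superinvariant_pair T e \<phi>"
    and "universal_completion J"
  shows "(\<forall>x. bdd_below {J (cesaro_mean T n \<bar>x\<bar>) |n. n \<ge> 1} \<and>
              bdd_above {J (cesaro_mean T n \<bar>x\<bar>) |n. n \<ge> 1} \<and>
              isLub UNIV {J (cesaro_mean T n \<bar>x\<bar>) |n. n \<ge> 1} (maximal_function J T x)) \<and>
         (\<forall>x c. c > 0 \<longrightarrow>
            (\<exists>q. J q = level_component J T e c x \<and> c * \<phi> q \<le> \<phi> \<bar>x\<bar>))"
proof -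
  interpret J: universal_completion_embedding J
    by (unfold_locales) (rule assms(3))
  have e: "weak_unit e" "0 \<le> e" "T e \<le> e"
    and phi: "positive_linear \<phi>" "strictly_positive \<phi>" "sigma_order_continuous \<phi>"
    and sub: "\<And>x. 0 \<le> x \<Longrightarrow> \<phi> (T x) \<le> \<phi> x"
    using assms(2) by (auto simp: superinvariant_pair_def weak_unit_def)
  define A where "A x = running_max (\<lambda>n. cesaro_mean T n \<bar>x\<bar>)" for x
  have A: "incseq (A x)" for x
    unfolding A_def by (rule incseq_running_max)
  have weak: "c * \<phi> (exceedance e (A x) c) \<le> \<phi> \<bar>x\<bar>" if "0 < c" for c x
  proof -
    have "\<phi> (exceedance_seq e (A x) c m) \<le> \<phi> \<bar>x\<bar> / c" for m
      using maximal_inequality[OF assms(1) phi(1) e(2,3) sub abs_ge_zero, of c x m] that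
      by (simp add: A_def field_simps)
    then have "\<phi> (exceedance e (A x) c) \<le> \<phi> \<bar>x\<bar> / c"
      by (rule functional_exceedance_le[OF phi(1,3) A])
    with that show ?thesis by (simp add: field_simps)
  qed
  have bdd: "bdd_above (range (\<lambda>m. J (A x m)))" for x
  proof (rule J.bdd_above_if_exceedance_tendsto_0[OF e(1) A phi(1,2)])
    \<comment> \<open>The weak inequality at \<open>c = k\<close> bounds the values by
      \<open>\<phi> \<bar>x\<bar> / k\<close> once \<open>k > 0\<close>.\<close>
    show "(\<lambda>k. \<phi> (exceedance e (A x) (real k))) \<longlonglongrightarrow> 0"
    proof (rule tendsto_sandwich)
      show "\<forall>\<^sub>F k in sequentially. 0 \<le> \<phi> (exceedance e (A x) (real k))"
        using phi(1) e(2) by (simp add: positive_linear_def exceedance_nonneg)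
      show "\<forall>\<^sub>F k in sequentially. \<phi> (exceedance e (A x) (real k)) \<le> \<phi> \<bar>x\<bar> / real k"
        using eventually_gt_at_top[of 0]
        by eventually_elim (use weak in \<open>simp add: field_simps\<close>)
      show "(\<lambda>k. \<phi> \<bar>x\<bar> / real k) \<longlonglongrightarrow> 0" by (rule lim_const_over_n)
    qed simp
  qed
  let ?S = "\<lambda>x. (\<lambda>n. J (cesaro_mean T n \<bar>x\<bar>)) ` {1..}"
  have S: "{J (cesaro_mean T n \<bar>x\<bar>) |n. n \<ge> 1} = ?S x" for x by auto
  have J_nonneg: "0 \<le> J (cesaro_mean T n \<bar>x\<bar>)" for n x
    using cesaro_mean_nonneg[OF assms(1)] by (simp add: J.nonneg_iff)
  have mean_le: "J (cesaro_mean T n \<bar>x\<bar>) \<le> (SUP m. J (A x m))" for n x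
  proof -
    have "J (cesaro_mean T n \<bar>x\<bar>) \<le> J (A x n)"
      using le_running_max[of n n "\<lambda>n. cesaro_mean T n \<bar>x\<bar>"] by (simp add: A_def J.le_iff)
    also have "\<dots> \<le> (SUP m. J (A x m))" using bdd by (rule cSUP_upper[OF UNIV_I])
    finally show ?thesis .
  qed
  have bddS: "bdd_above (?S x)" for x
    by (rule bdd_aboveI2) (rule mean_le)
  \<comment> \<open>The running maxima also include the average at index \<open>0\<close>, which is
    \<open>0\<close>; as all averages are nonnegative, the supremum is unchanged.\<close>
  have max_eq: "maximal_function J T x = (SUP m. J (A x m))" for x
  proof (rule antisym)
    show "maximal_function J T x \<le> (SUP m. J (A x m))"
      unfolding maximal_function_def using mean_le by (intro cSUP_least) auto
    have le: "J (cesaro_mean T n \<bar>x\<bar>) \<le> maximal_function J T x" if "1 \<le> n" for n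
      unfolding maximal_function_def using that bddS by (intro cSUP_upper) auto
    have "0 \<le> maximal_function J T x" using J_nonneg le[of 1] by (meson order_refl order_trans)
    then have le': "J (cesaro_mean T n \<bar>x\<bar>) \<le> maximal_function J T x" for n
      using le[of n] by (cases "n = 0") (auto simp: cesaro_mean_def J.zero)
    have "J (A x m) \<le> maximal_function J T x" for m
    proof -
      \<comment> \<open>\<open>J\<close> commutes with this finite maximum, so each average can be
        bounded separately.\<close>
      have "J (A x m) = Sup (J ` (\<lambda>n. cesaro_mean T n \<bar>x\<bar>) ` {..m})"
        unfolding A_def running_max_def by (rule J.Sup_eq) auto
      also have "\<dots> \<le> maximal_function J T x"
        by (rule cSup_least) (auto simp: le')
      finally show ?thesis .
    qed
    then show "(SUP m. J (A x m)) \<le> maximal_function J T x" by (intro cSUP_least) auto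
  qed
  have "bdd_below (?S x) \<and> bdd_above (?S x) \<and> isLub UNIV (?S x) (maximal_function J T x)" for x
    unfolding isLub_UNIV_iff maximal_function_def
    using J_nonneg bddS[of x]
    by (auto intro: bdd_belowI2[where m = 0] cSUP_upper simp: cSUP_le_iff)
  \<comment> \<open>The level component takes the maximal function at \<open>\<bar>x\<bar>\<close>,
    whose own modulus is again \<open>\<bar>x\<bar>\<close>.\<close>
  moreover have "J (exceedance e (A x) c) = level_component J T e c x" for x c
    using J.band_projection_exceedance[OF e(2) A bdd, of x c]
    by (simp add: level_component_def max_eq) (simp add: A_def)
  ultimately show ?thesis unfolding S using weak by blast
qed

end
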